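(* For any finite pointed poset $\mathcal{P}$, its simplicial transform $s(\mathcal{P})$ is a simplicial poset with the same vertex set as $\mathcal{P}$.
   Context: A poset $\mathcal{P}$ is pointed if it has a least object $*$. A vertex is an object $v\ne *$ such that $y<v$ implies $y=*$. $V_\mathcal{P}$ is the set of vertices, and $V(x)=\{v\in V_\mathcal{P}\mid v\le x\}$. $[x\vee y]$ is the set of minimal upper bounds of $\{x,y\}$. Simplicial transform: on the set of pairs $(x,S)$ with $x\in\mathcal{P}$ and $S\subseteq V(x)$, take the equivalence relation that is the transitive closure of the relation $(x,S)\sim(y,T)$ if $S=T$ and $[x\vee y]\ne\emptyset$. $s(\mathcal{P})$ is the set of equivalence classes $[x,S]$, partially ordered by $[x,S]\le[y,T]$ if, for some choice of representatives $(x,S)$ and $(y,T)$, $S\subseteq T$ and $[x\vee y]\ne\emptyset$. A pointed poset $\mathcal{Q}$ is simplicial if for each $x\in\mathcal{Q}$ the sub-poset $\mathcal{Q}_{\le x}=\{y\mid y\le x\}$ is isomorphic to a boolean algebra (the poset of all subsets of a finite set, i.e. the face poset of a simplex). "Same vertex set" means that $v\mapsto[v,\{v\}]$ is a bijection from $V_\mathcal{P}$ to $V_{s(\mathcal{P})}$. *)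

theory Defs
  imports Main
begin

text \<open>A poset is a carrier set \<open>A\<close> together with a relation \<open>r\<close> such that
  \<^const>\<open>partial_order_on\<close> holds; \<open>(x, y) \<in> r\<close> is read \<open>x \<le> y\<close>.\<close>

definition is_least :: "'a set \<Rightarrow> 'a rel \<Rightarrow> 'a \<Rightarrow> bool" where
  "is_least A r b \<longleftrightarrow> b \<in> A \<and> (\<forall>x\<in>A. (b, x) \<in> r)"

definition pointed_poset :: "'a set \<Rightarrow> 'a rel \<Rightarrow> bool" where
  "pointed_poset A r \<longleftrightarrow> partial_order_on A r \<and> (\<exists>b. is_least A r b)"

definition basepoint :: "'a set \<Rightarrow> 'a rel \<Rightarrow> 'a" where
  "basepoint A r = (THE b. is_least A r b)"

definition vertices :: "'a set \<Rightarrow> 'a rel \<Rightarrow> 'a set" where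
  "vertices A r = {v \<in> A. v \<noteq> basepoint A r \<and>
     (\<forall>y\<in>A. (y, v) \<in> r \<and> y \<noteq> v \<longrightarrow> y = basepoint A r)}"

definition vertices_below :: "'a set \<Rightarrow> 'a rel \<Rightarrow> 'a \<Rightarrow> 'a set" where
  "vertices_below A r x = {v \<in> vertices A r. (v, x) \<in> r}"

definition upper_bounds2 :: "'a set \<Rightarrow> 'a rel \<Rightarrow> 'a \<Rightarrow> 'a \<Rightarrow> 'a set" where
  "upper_bounds2 A r x y = {z \<in> A. (x, z) \<in> r \<and> (y, z) \<in> r}"

text \<open>The set \<open>[x \<or> y]\<close>.\<close>

definition min_upper_bounds :: "'a set \<Rightarrow> 'a rel \<Rightarrow> 'a \<Rightarrow> 'a \<Rightarrow> 'a set" where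
  "min_upper_bounds A r x y = {z \<in> upper_bounds2 A r x y.
     \<forall>w\<in>upper_bounds2 A r x y. (w, z) \<in> r \<longrightarrow> w = z}"

definition st_pairs :: "'a set \<Rightarrow> 'a rel \<Rightarrow> ('a \<times> 'a set) set" where
  "st_pairs A r = {(x, S). x \<in> A \<and> S \<subseteq> vertices_below A r x}"

definition st_step :: "'a set \<Rightarrow> 'a rel \<Rightarrow> ('a \<times> 'a set) rel" where
  "st_step A r = {((x, S), (y, T)).
     (x, S) \<in> st_pairs A r \<and> (y, T) \<in> st_pairs A r \<and>
     S = T \<and> min_upper_bounds A r x y \<noteq> {}}"

definition st_equiv :: "'a set \<Rightarrow> 'a rel \<Rightarrow> ('a \<times> 'a set) rel" where
  "st_equiv A r = (st_step A r)\<^sup>+"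

lemma equiv_st_equiv:
  assumes "partial_order_on A r"
  shows "equiv (st_pairs A r) (st_equiv A r)"
proof -
  have refl: "(x, x) \<in> r" if "x \<in> A" for x
    using assms that by (auto simp: partial_order_on_def preorder_on_def refl_on_def)
  have anti: "antisym r"
    using assms by (simp add: partial_order_on_def)
  have "x \<in> min_upper_bounds A r x x" if "x \<in> A" for x
    using that refl anti
    by (auto simp: min_upper_bounds_def upper_bounds2_def dest: antisymD)
  then have "refl_on (st_pairs A r) (st_step A r)"
    by (fastforce simp: refl_on_def st_step_def st_pairs_def)
  then have "refl_on (st_pairs A r) (st_equiv A r)"
    by (auto simp: refl_on_def st_equiv_def)
  moreover have "sym (st_step A r)"
    by (auto simp: sym_def st_step_def min_upper_bounds_def upper_bounds2_def)
  then have "sym (st_equiv A r)"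
    unfolding st_equiv_def by (rule sym_trancl)
  moreover have "st_step A r \<subseteq> st_pairs A r \<times> st_pairs A r"
    by (auto simp: st_step_def)
  then have "st_equiv A r \<subseteq> st_pairs A r \<times> st_pairs A r"
    unfolding st_equiv_def by (rule trancl_subset_Sigma)
  ultimately show ?thesis
    by (auto simp: equiv_def st_equiv_def)
qed

text \<open>The class \<open>[x, S]\<close>.\<close>

definition st_class :: "'a set \<Rightarrow> 'a rel \<Rightarrow> 'a \<Rightarrow> 'a set \<Rightarrow> ('a \<times> 'a set) set" where
  "st_class A r x S = st_equiv A r `` {(x, S)}"

definition st_carrier :: "'a set \<Rightarrow> 'a rel \<Rightarrow> ('a \<times> 'a set) set set" where
  "st_carrier A r = st_pairs A r // st_equiv A r"

definition st_order :: "'a set \<Rightarrow> 'a rel \<Rightarrow> ('a \<times> 'a set) set rel" where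
  "st_order A r = {(a, b). a \<in> st_carrier A r \<and> b \<in> st_carrier A r \<and>
     (\<exists>(x, S)\<in>a. \<exists>(y, T)\<in>b. S \<subseteq> T \<and> min_upper_bounds A r x y \<noteq> {})}"

text \<open>Order isomorphism of \<open>(A, r)\<close> and \<open>(B, s)\<close>; only the restrictions of the relations
  to the carriers matter.\<close>

definition order_isomorphic :: "'a set \<Rightarrow> 'a rel \<Rightarrow> 'b set \<Rightarrow> 'b rel \<Rightarrow> bool" where
  "order_isomorphic A r B s \<longleftrightarrow>
     (\<exists>f. bij_betw f A B \<and> (\<forall>x\<in>A. \<forall>y\<in>A. (x, y) \<in> r \<longleftrightarrow> (f x, f y) \<in> s))"

text \<open>The finite set underlying the boolean algebra is taken in \<^typ>\<open>nat\<close>. This is no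
  restriction: every finite set is in bijection with a finite set of natural numbers.\<close>

definition simplicial_poset :: "'a set \<Rightarrow> 'a rel \<Rightarrow> bool" where
  "simplicial_poset Q q \<longleftrightarrow> pointed_poset Q q \<and>
     (\<forall>x\<in>Q. \<exists>B :: nat set. finite B \<and>
        order_isomorphic {y \<in> Q. (y, x) \<in> q} q (Pow B) {(S, T). S \<subseteq> T})"

end

theory Submission
  imports Defs
begin

text \<open>The idea is that once an element \<open>y\<close> is chosen, every face of \<open>[y, T]\<close> can be represented
  over that same \<open>y\<close>: if \<open>S \<subseteq> T\<close> and \<open>x\<close>, \<open>y\<close> have an upper bound, then already
  \<open>[x, S] = [y, S]\<close>, since \<open>S \<subseteq> T \<subseteq> V(y)\<close>. Moreover \<open>S\<close> is an invariant of the class \<open>[x, S]\<close>,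
  and equivalent pairs stay equivalent when their vertex set is shrunk, so the choice of \<open>y\<close> is
  immaterial. Hence \<open>[x, S] \<le> [y, T]\<close> holds exactly if \<open>S \<subseteq> T\<close> and \<open>[y, S] = [x, S]\<close>
  (lemma \<open>st_class_le_iff\<close>).

  Everything follows from this description. The order axioms reduce to those of \<open>\<subseteq>\<close>,
  with shrinking of vertex sets used once more for transitivity; the lower set of
  \<open>[y, T]\<close> consists of the classes \<open>[y, S]\<close> with \<open>S \<subseteq> T\<close>, ordered by inclusion of the \<open>S\<close>, which is the boolean algebra on the finite set \<open>T\<close>; the least element is \<open>[*, \<emptyset>]\<close>; and the
  vertices are the \<open>[x, S]\<close> with \<open>S = {v}\<close> a singleton. Since \<open>v \<le> x\<close> in that case, such a vertex
  equals \<open>[v, {v}]\<close>, and \<open>v\<close> is recovered from it by the invariance of \<open>S\<close>.\<close>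

section \<open>Pointed posets\<close>

lemma basepoint_eqI:
  assumes "antisym r" and "is_least A r b"
  shows "basepoint A r = b"
  unfolding basepoint_def
proof (rule the_equality)
  show "is_least A r b" by fact
  show "c = b" if "is_least A r c" for c
    using that assms by (auto simp: is_least_def dest: antisymD)
qed

locale finite_pointed_poset =
  fixes P :: "'a set" and r :: "'a rel"
  assumes finite_carrier: "finite P"
    and pointed: "pointed_poset P r"
begin

lemma partial_order: "partial_order_on P r"
  using pointed by (simp add: pointed_poset_def)

lemma refl: "x \<in> P \<Longrightarrow> (x, x) \<in> r"
  using partial_order by (auto simp: partial_order_on_def preorder_on_def refl_on_def)

lemma antisym: "antisym r"
  using partial_order by (simp add: partial_order_on_def)

lemma trans: "(x, y) \<in> r \<Longrightarrow> (y, z) \<in> r \<Longrightarrow> (x, z) \<in> r"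
  using partial_order by (auto simp: partial_order_on_def preorder_on_def dest: transD)

lemma is_least_basepoint: "is_least P r (basepoint P r)"
  using pointed antisym by (metis basepoint_eqI pointed_poset_def)

lemma vertex_in_carrier: "v \<in> vertices P r \<Longrightarrow> v \<in> P"
  by (simp add: vertices_def)

text \<open>By finiteness, a minimal upper bound exists below any upper bound; this is what lets
  \<open>[x \<or> y] \<noteq> \<emptyset>\<close> be checked without regard to minimality.\<close>

lemma min_upper_bounds_nonempty_iff:
  "min_upper_bounds P r x y \<noteq> {} \<longleftrightarrow> (\<exists>z\<in>P. (x, z) \<in> r \<and> (y, z) \<in> r)"
proof
  assume "min_upper_bounds P r x y \<noteq> {}"
  then show "\<exists>z\<in>P. (x, z) \<in> r \<and> (y, z) \<in> r"
    by (auto simp: min_upper_bounds_def upper_bounds2_def)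
next
  let ?U = "upper_bounds2 P r x y"
  assume "\<exists>z\<in>P. (x, z) \<in> r \<and> (y, z) \<in> r"
  then have ne: "?U \<noteq> {}" by (auto simp: upper_bounds2_def)
  have fin: "finite ?U" using finite_carrier by (simp add: upper_bounds2_def)
  have "asymp_on ?U (\<lambda>w z. (w, z) \<in> r \<and> w \<noteq> z)"
    using antisym by (auto intro!: asymp_onI dest: antisymD)
  moreover have "transp_on ?U (\<lambda>w z. (w, z) \<in> r \<and> w \<noteq> z)"
    using antisym by (auto intro!: transp_onI dest: antisymD intro: trans)
  ultimately obtain z where "z \<in> ?U" "\<forall>w\<in>?U. w \<noteq> z \<longrightarrow> \<not> ((w, z) \<in> r \<and> w \<noteq> z)"
    using Finite_Set.bex_min_element[OF fin _ _ ne] by blast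
  then show "min_upper_bounds P r x y \<noteq> {}"
    by (auto simp: min_upper_bounds_def)
qed

section \<open>Equivalence of pairs\<close>

lemma in_st_pairs_iff: "(x, S) \<in> st_pairs P r \<longleftrightarrow> x \<in> P \<and> S \<subseteq> vertices_below P r x"
  by (simp add: st_pairs_def)

lemma st_pairs_mono: "(x, T) \<in> st_pairs P r \<Longrightarrow> S \<subseteq> T \<Longrightarrow> (x, S) \<in> st_pairs P r"
  by (auto simp: in_st_pairs_iff)

lemma st_equivI:
  assumes "(x, S) \<in> st_pairs P r" "(y, S) \<in> st_pairs P r" "min_upper_bounds P r x y \<noteq> {}"
  shows "((x, S), (y, S)) \<in> st_equiv P r"
  using assms by (auto simp: st_equiv_def st_step_def)

lemma st_equivI_le:
  assumes "(x, S) \<in> st_pairs P r" "(y, S) \<in> st_pairs P r" "(x, y) \<in> r"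
  shows "((x, S), (y, S)) \<in> st_equiv P r"
  using assms refl by (intro st_equivI) (auto simp: min_upper_bounds_nonempty_iff in_st_pairs_iff)

text \<open>Each step keeps the second component, and having an upper bound depends on the first
  components only. So a chain of steps keeps the vertex set, and it remains a chain after the
  vertex set is replaced by a subset.\<close>

lemma st_equiv_shrink:
  assumes "((x, T), (y, T')) \<in> st_equiv P r"
  shows "T' = T \<and> (\<forall>S\<subseteq>T. ((x, S), (y, S)) \<in> st_equiv P r)"
proof -
  have single: "T' = T \<and> (\<forall>S\<subseteq>T. ((x, S), (y, S)) \<in> st_equiv P r)"
    if "((x, T), (y, T')) \<in> st_step P r" for x y T T'
    using that by (auto simp: st_step_def intro!: st_equivI elim: st_pairs_mono)
  have "((x, T), (y, T')) \<in> (st_step P r)\<^sup>+"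
    using assms by (simp add: st_equiv_def)
  then show ?thesis
  proof (induction rule: trancl_induct2)
    case (base y T')
    then show ?case by (rule single)
  next
    case (step y T' z U)
    from \<open>((y, T'), (z, U)) \<in> st_step P r\<close>
    have "U = T' \<and> (\<forall>S\<subseteq>T'. ((y, S), (z, S)) \<in> st_equiv P r)"
      by (rule single)
    then show ?case
      using step.IH unfolding st_equiv_def by (blast intro: trancl_trans)
  qed
qed

lemma st_class_eq_iff:
  assumes "(x, S) \<in> st_pairs P r" "(y, T) \<in> st_pairs P r"
  shows "st_class P r x S = st_class P r y T \<longleftrightarrow> ((x, S), (y, T)) \<in> st_equiv P r"
  unfolding st_class_def
  using assms by (intro eq_equiv_class_iff[OF equiv_st_equiv[OF partial_order]])

lemma st_class_eqD:
  assumes "(x, S) \<in> st_pairs P r" "(y, T) \<in> st_pairs P r"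
    and "st_class P r x S = st_class P r y T"
  shows "S = T"
  using assms st_class_eq_iff st_equiv_shrink[of x S y T] by simp

lemma st_class_shrink:
  assumes "(x, T) \<in> st_pairs P r" "(y, T) \<in> st_pairs P r"
    and "st_class P r x T = st_class P r y T" and "S \<subseteq> T"
  shows "st_class P r x S = st_class P r y S"
proof -
  have "((x, S), (y, S)) \<in> st_equiv P r"
    using assms st_class_eq_iff[of x T y T] st_equiv_shrink[of x T y T] by simp
  then show ?thesis
    using assms st_class_eq_iff[of x S y S] st_pairs_mono[of _ T S] by simp
qed

lemma st_class_eq_of_le:
  assumes "(x, S) \<in> st_pairs P r" "y \<in> P" "(x, y) \<in> r"
  shows "st_class P r x S = st_class P r y S"
proof -
  have "(y, S) \<in> st_pairs P r"
    using assms trans by (fastforce simp: in_st_pairs_iff vertices_below_def)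
  then show ?thesis
    using assms st_class_eq_iff st_equivI_le by blast
qed

lemma st_class_in_carrier: "(x, S) \<in> st_pairs P r \<Longrightarrow> st_class P r x S \<in> st_carrier P r"
  by (simp add: st_class_def st_carrier_def quotientI)

lemma st_carrierE:
  assumes "a \<in> st_carrier P r"
  obtains x S where "(x, S) \<in> st_pairs P r" "a = st_class P r x S"
  using assms by (auto simp: st_carrier_def st_class_def elim!: quotientE)

lemma in_st_class_iff:
  assumes "(x, S) \<in> st_pairs P r"
  shows "(y, T) \<in> st_class P r x S \<longleftrightarrow>
    T = S \<and> (y, S) \<in> st_pairs P r \<and> st_class P r y S = st_class P r x S"
proof -
  have "st_equiv P r \<subseteq> st_pairs P r \<times> st_pairs P r"
    using equiv_st_equiv[OF partial_order] by (simp add: equiv_def refl_on_def)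
  then show ?thesis
    using st_class_eq_iff[OF assms, of y S] st_equiv_shrink[of x S y T]
    unfolding st_class_def[of _ _ x S] by auto
qed

section \<open>The order and its lower sets\<close>

text \<open>If representatives \<open>(x', S)\<close> and \<open>(y', T)\<close> witness \<open>[x, S] \<le> [y, T]\<close>, then \<open>x'\<close> and \<open>y'\<close> have
  an upper bound, so \<open>(x', S) \<sim> (y', S)\<close>; by \<open>st_class_shrink\<close> this transfers to any other
  representative of \<open>[y, T]\<close>. The existential choice of representatives thereby disappears.\<close>

lemma st_class_le_iff:
  assumes "(x, S) \<in> st_pairs P r" "(y, T) \<in> st_pairs P r"
  shows "(st_class P r x S, st_class P r y T) \<in> st_order P r \<longleftrightarrow>
    S \<subseteq> T \<and> st_class P r y S = st_class P r x S"
proof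
  assume "(st_class P r x S, st_class P r y T) \<in> st_order P r"
  then obtain x' S' y' T' where
    x': "(x', S') \<in> st_class P r x S" and y': "(y', T') \<in> st_class P r y T"
    and sub: "S' \<subseteq> T'" and ub: "min_upper_bounds P r x' y' \<noteq> {}"
    unfolding st_order_def by blast
  have px: "(x', S) \<in> st_pairs P r" and ex: "st_class P r x' S = st_class P r x S" and S: "S' = S"
    using x' in_st_class_iff[OF assms(1)] by auto
  have py: "(y', T) \<in> st_pairs P r" and ey: "st_class P r y' T = st_class P r y T" and T: "T' = T"
    using y' in_st_class_iff[OF assms(2)] by auto
  have ST: "S \<subseteq> T" using sub S T by simp
  have pyS: "(y', S) \<in> st_pairs P r" using py ST by (rule st_pairs_mono)
  have "st_class P r y S = st_class P r y' S"
    using st_class_shrink[OF py assms(2) ey ST] by simp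
  also have "\<dots> = st_class P r x' S"
    using st_class_eq_iff[OF px pyS] st_equivI[OF px pyS ub] by simp
  finally show "S \<subseteq> T \<and> st_class P r y S = st_class P r x S"
    using ST ex by simp
next
  assume *: "S \<subseteq> T \<and> st_class P r y S = st_class P r x S"
  then have "(y, S) \<in> st_class P r x S"
    using assms(2) by (simp add: in_st_class_iff[OF assms(1)] st_pairs_mono[of y T S])
  moreover have "(y, T) \<in> st_class P r y T"
    using assms(2) by (simp add: in_st_class_iff)
  moreover have "min_upper_bounds P r y y \<noteq> {}"
    using assms refl by (auto simp: min_upper_bounds_nonempty_iff in_st_pairs_iff)
  ultimately show "(st_class P r x S, st_class P r y T) \<in> st_order P r"
    using * assms st_class_in_carrier by (fastforce simp: st_order_def)
qed

lemma partial_order_st: "partial_order_on (st_carrier P r) (st_order P r)"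
proof -
  have sub: "st_order P r \<subseteq> st_carrier P r \<times> st_carrier P r"
    by (auto simp: st_order_def)
  have "refl_on (st_carrier P r) (st_order P r)"
    unfolding refl_on_def using sub by (auto elim!: st_carrierE simp: st_class_le_iff)
  moreover have "trans (st_order P r)"
  proof (rule transI)
    fix a b c assume ab: "(a, b) \<in> st_order P r" and bc: "(b, c) \<in> st_order P r"
    obtain x S where x: "(x, S) \<in> st_pairs P r" "a = st_class P r x S"
      using ab sub by (blast elim: st_carrierE)
    obtain y T where y: "(y, T) \<in> st_pairs P r" "b = st_class P r y T"
      using ab sub by (blast elim: st_carrierE)
    obtain z U where z: "(z, U) \<in> st_pairs P r" "c = st_class P r z U"
      using bc sub by (blast elim: st_carrierE)
    have ST: "S \<subseteq> T" and exy: "st_class P r y S = st_class P r x S"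
      using ab x y by (simp_all add: st_class_le_iff)
    have TU: "T \<subseteq> U" and eyz: "st_class P r z T = st_class P r y T"
      using bc y z by (simp_all add: st_class_le_iff)
    have "st_class P r z S = st_class P r y S"
      using st_class_shrink[OF st_pairs_mono[OF z(1) TU] y(1) eyz ST] .
    then show "(a, c) \<in> st_order P r"
      using x z ST TU exy by (simp add: st_class_le_iff)
  qed
  moreover have "antisym (st_order P r)"
  proof (rule antisymI)
    fix a b assume ab: "(a, b) \<in> st_order P r" and ba: "(b, a) \<in> st_order P r"
    obtain x S where x: "(x, S) \<in> st_pairs P r" "a = st_class P r x S"
      using ab sub by (blast elim: st_carrierE)
    obtain y T where y: "(y, T) \<in> st_pairs P r" "b = st_class P r y T"
      using ab sub by (blast elim: st_carrierE)
    have "S = T" "st_class P r y S = st_class P r x S"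
      using ab ba x y by (auto simp: st_class_le_iff)
    then show "a = b" using x y by simp
  qed
  ultimately show ?thesis
    using sub by (auto simp: partial_order_on_def preorder_on_def)
qed

lemma empty_in_st_pairs: "x \<in> P \<Longrightarrow> (x, {}) \<in> st_pairs P r"
  by (simp add: in_st_pairs_iff)

lemma is_least_st: "is_least (st_carrier P r) (st_order P r) (st_class P r (basepoint P r) {})"
proof -
  have b: "basepoint P r \<in> P" "\<And>x. x \<in> P \<Longrightarrow> (basepoint P r, x) \<in> r"
    using is_least_basepoint by (auto simp: is_least_def)
  have "(st_class P r (basepoint P r) {}, a) \<in> st_order P r" if a: "a \<in> st_carrier P r" for a
  proof -
    obtain x S where x: "(x, S) \<in> st_pairs P r" "a = st_class P r x S"
      using a by (rule st_carrierE)
    then have "x \<in> P" by (simp add: in_st_pairs_iff)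
    then show ?thesis
      using x b st_class_eq_of_le[OF empty_in_st_pairs[OF b(1)]]
      by (simp add: st_class_le_iff empty_in_st_pairs)
  qed
  then show ?thesis
    using b(1) by (auto simp: is_least_def intro!: st_class_in_carrier empty_in_st_pairs)
qed

lemma basepoint_st:
  "basepoint (st_carrier P r) (st_order P r) = st_class P r (basepoint P r) {}"
  using partial_order_st is_least_st by (intro basepoint_eqI) (simp_all add: partial_order_on_def)

lemma st_class_eq_basepoint_iff:
  assumes "(x, S) \<in> st_pairs P r"
  shows "st_class P r x S = basepoint (st_carrier P r) (st_order P r) \<longleftrightarrow> S = {}"
proof -
  have b: "basepoint P r \<in> P" "x \<in> P" "(basepoint P r, x) \<in> r"
    using is_least_basepoint assms by (auto simp: is_least_def in_st_pairs_iff)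
  show ?thesis
    unfolding basepoint_st
    using st_class_eqD[OF assms empty_in_st_pairs[OF b(1)]]
      st_class_eq_of_le[OF empty_in_st_pairs[OF b(1)] b(2,3)] by auto
qed

text \<open>By \<open>st_class_le_iff\<close>, \<open>S \<mapsto> [y, S]\<close> is an isomorphism from the subsets of \<open>T\<close> onto the lower
  set of \<open>[y, T]\<close>. Its inverse, followed by an enumeration of \<open>T\<close> by natural numbers, has the
  required form.\<close>

lemma lower_set_boolean:
  assumes y: "(y, T) \<in> st_pairs P r"
  shows "\<exists>B :: nat set. finite B \<and>
    order_isomorphic {a \<in> st_carrier P r. (a, st_class P r y T) \<in> st_order P r} (st_order P r)
      (Pow B) {(S, T). S \<subseteq> T}"
proof -
  let ?L = "{a \<in> st_carrier P r. (a, st_class P r y T) \<in> st_order P r}"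
  let ?g = "\<lambda>S. st_class P r y S"
  have pairs: "(y, S) \<in> st_pairs P r" if "S \<subseteq> T" for S
    using y that by (rule st_pairs_mono)
  have "T \<subseteq> P"
    using y by (auto simp: in_st_pairs_iff vertices_below_def vertices_def)
  then have "finite T" using finite_carrier by (rule finite_subset)
  then obtain h :: "'a \<Rightarrow> nat" where h: "bij_betw h T {0..<card T}"
    using ex_bij_betw_finite_nat by blast
  have g: "bij_betw ?g (Pow T) ?L"
  proof (rule bij_betw_imageI)
    show "inj_on ?g (Pow T)"
      by (rule inj_onI, rule st_class_eqD[of y _ y]) (use pairs in auto)
    have "?g S \<in> ?L" if "S \<subseteq> T" for S
      using that y pairs st_class_in_carrier by (simp add: st_class_le_iff)
    moreover have "a \<in> ?g ` Pow T" if "a \<in> ?L" for a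
      using that y by (force elim!: st_carrierE simp: st_class_le_iff)
    ultimately show "?g ` Pow T = ?L" by auto
  qed
  let ?f = "(`) h \<circ> the_inv_into (Pow T) ?g"
  have "bij_betw ?f ?L (Pow {0..<card T})"
    using bij_betw_the_inv_into[OF g] bij_betw_Pow[OF h] by (rule bij_betw_trans)
  moreover have "(a, b) \<in> st_order P r \<longleftrightarrow> ?f a \<subseteq> ?f b" if ab: "a \<in> ?L" "b \<in> ?L" for a b
  proof -
    have "a \<in> ?g ` Pow T" "b \<in> ?g ` Pow T"
      using ab bij_betw_imp_surj_on[OF g] by simp_all
    then obtain S S' where S: "S \<subseteq> T" "a = ?g S" and S': "S' \<subseteq> T" "b = ?g S'"
      by blast
    have "(a, b) \<in> st_order P r \<longleftrightarrow> S \<subseteq> S'"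
      using S S' pairs by (simp add: st_class_le_iff)
    also have "\<dots> \<longleftrightarrow> h ` S \<subseteq> h ` S'"
      using inj_on_image_mem_iff[OF bij_betw_imp_inj_on[OF h] _ S'(1)] S(1) by blast
    finally show ?thesis
      using S S' g by (simp add: bij_betw_def the_inv_into_f_f)
  qed
  ultimately have "order_isomorphic ?L (st_order P r) (Pow {0..<card T}) {(S, T). S \<subseteq> T}"
    unfolding order_isomorphic_def by blast
  then show ?thesis by blast
qed

theorem simplicial_poset_st: "simplicial_poset (st_carrier P r) (st_order P r)"
  unfolding simplicial_poset_def pointed_poset_def
proof (intro conjI ballI)
  show "\<exists>b. is_least (st_carrier P r) (st_order P r) b"
    using is_least_st by blast
  fix a
  assume "a \<in> st_carrier P r"
  then obtain y T where "(y, T) \<in> st_pairs P r" "a = st_class P r y T"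
    by (rule st_carrierE)
  then show "\<exists>B :: nat set. finite B \<and>
      order_isomorphic {b \<in> st_carrier P r. (b, a) \<in> st_order P r} (st_order P r)
        (Pow B) {(S, T). S \<subseteq> T}"
    using lower_set_boolean by simp
qed (rule partial_order_st)

section \<open>The vertices of the transform\<close>

lemma vertex_in_st_pairs: "v \<in> vertices P r \<Longrightarrow> (v, {v}) \<in> st_pairs P r"
  using refl by (auto simp: in_st_pairs_iff vertices_below_def vertex_in_carrier)

text \<open>If \<open>S\<close> had a proper nonempty subset \<open>R\<close>, then \<open>[x, R]\<close> would lie strictly between the
  basepoint and \<open>[x, S]\<close>. Conversely only \<open>{}\<close> is a proper subset of a singleton.\<close>

lemma st_class_vertex_iff:
  assumes x: "(x, S) \<in> st_pairs P r"
  shows "st_class P r x S \<in> vertices (st_carrier P r) (st_order P r) \<longleftrightarrow> (\<exists>v. S = {v})"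
proof
  assume vert: "st_class P r x S \<in> vertices (st_carrier P r) (st_order P r)"
  then have "S \<noteq> {}"
    using st_class_eq_basepoint_iff[OF x] by (auto simp: vertices_def)
  then obtain v where v: "v \<in> S" by blast
  then have pv: "(x, {v}) \<in> st_pairs P r" using st_pairs_mono[OF x] by simp
  have "(st_class P r x {v}, st_class P r x S) \<in> st_order P r"
    using v pv x by (simp add: st_class_le_iff)
  then have "st_class P r x {v} = st_class P r x S"
    using vert st_class_in_carrier[OF pv] st_class_eq_basepoint_iff[OF pv]
    by (auto simp: vertices_def)
  then show "\<exists>v. S = {v}" using st_class_eqD[OF pv x] by blast
next
  assume "\<exists>v. S = {v}"
  then obtain v where v: "S = {v}" by blast
  have "a = basepoint (st_carrier P r) (st_order P r)"
    if a: "a \<in> st_carrier P r" "(a, st_class P r x S) \<in> st_order P r" "a \<noteq> st_class P r x S" for a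
  proof -
    obtain y R where y: "(y, R) \<in> st_pairs P r" "a = st_class P r y R"
      using a(1) by (rule st_carrierE)
    then have "R \<subseteq> {v}" "R \<noteq> {v}"
      using a x v by (auto simp: st_class_le_iff)
    then have "R = {}" by blast
    then show ?thesis using y st_class_eq_basepoint_iff by blast
  qed
  then show "st_class P r x S \<in> vertices (st_carrier P r) (st_order P r)"
    using v st_class_in_carrier[OF x] st_class_eq_basepoint_iff[OF x] by (auto simp: vertices_def)
qed

theorem bij_betw_vertices:
  "bij_betw (\<lambda>v. st_class P r v {v}) (vertices P r) (vertices (st_carrier P r) (st_order P r))"
proof (rule bij_betw_imageI)
  show "inj_on (\<lambda>v. st_class P r v {v}) (vertices P r)"
  proof (rule inj_onI)
    fix v w
    assume "v \<in> vertices P r" "w \<in> vertices P r" "st_class P r v {v} = st_class P r w {w}"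
    then have "{v} = {w}"
      by (intro st_class_eqD[of v _ w] vertex_in_st_pairs)
    then show "v = w" by simp
  qed
  have "a \<in> (\<lambda>v. st_class P r v {v}) ` vertices P r"
    if a: "a \<in> vertices (st_carrier P r) (st_order P r)" for a
  proof -
    have "a \<in> st_carrier P r" using a by (simp add: vertices_def)
    then obtain x S where x: "(x, S) \<in> st_pairs P r" "a = st_class P r x S"
      by (rule st_carrierE)
    then obtain v where v: "S = {v}" using a st_class_vertex_iff by blast
    then have "v \<in> vertices P r" "(v, x) \<in> r" "x \<in> P"
      using x by (auto simp: in_st_pairs_iff vertices_below_def)
    moreover from this have "st_class P r v {v} = a"
      using x v st_class_eq_of_le vertex_in_st_pairs by blast
    ultimately show ?thesis by blast
  qed
  then show "(\<lambda>v. st_class P r v {v}) ` vertices P r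
      = vertices (st_carrier P r) (st_order P r)"
    using vertex_in_st_pairs st_class_vertex_iff by blast
qed

end

theorem lemma6p3:
  fixes P :: "'a set" and r :: "'a rel"
  assumes "finite P" and "pointed_poset P r"
  shows "simplicial_poset (st_carrier P r) (st_order P r) \<and>
    bij_betw (\<lambda>v. st_class P r v {v})
      (vertices P r) (vertices (st_carrier P r) (st_order P r))"
proof -
  interpret finite_pointed_poset P r
    using assms by unfold_locales
  show ?thesis
    using simplicial_poset_st bij_betw_vertices by blast
qed

end
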